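(* Let $G$ be a graph of connectivity $k$, let $Q$ be a spanning tree of $G$, and set $\mathfrak{S}:=\{V(e):\, e\in E(Q)\}$. Suppose that every $\mathfrak{S}$-fragment has cardinality at least $\frac{k-1}{2}$, and let $B$ be an $\mathfrak{S}$-end. Then $|B|=\frac{k-1}{2}$ (in particular $k$ is odd), or every edge $e$ of $Q$ with $|V(e)\cap B|=1$ is $k$-contractible.
   Context: All graphs are finite, simple and undirected. $G$ is $k$-connected if $|V(G)|>k$ and $G-T$ is connected for all $T\subseteq V(G)$ with $|T|<k$; the connectivity $\kappa(G)$ is the largest $k$ with $G$ $k$-connected. An edge $e$ of a $k$-connected graph is $k$-contractible if the graph $G/e$ (identify the endvertices of $e$ and simplify) is $k$-connected. A smallest separating set is a $T\subseteq V(G)$ with $|T|=\kappa(G)$ and $G-T$ disconnected; $\mathfrak{T}(G)$ is the set of these. For $T\in\mathfrak{T}(G)$, a $T$-fragment is the union of the vertex sets of at least one but not all components of $G-T$ (then $T=N_G(F)$). For a family $\mathfrak{S}$ of vertex subsets, a $T$-fragment $F$ is a $T$-$\mathfrak{S}$-fragment if $S\subseteq T$ for some $S\in\mathfrak{S}$; an $\mathfrak{S}$-fragment is a $T$-$\mathfrak{S}$-fragment for some $T\in\mathfrak{T}(G)$; an $\mathfrak{S}$-end is an $\mathfrak{S}$-fragment that properly contains no other $\mathfrak{S}$-fragment. *)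

theory Defs
  imports Complex_Main
begin

text \<open>An edge is the set of its two endvertices, so that \<open>V(e)\<close> is \<open>e\<close> itself.\<close>

record 'a ugraph =
  verts :: "'a set"
  edges :: "'a set set"

definition simple_graph :: "'a ugraph \<Rightarrow> bool" where
  "simple_graph G \<longleftrightarrow> finite (verts G) \<and> (\<forall>e\<in>edges G. e \<subseteq> verts G \<and> card e = 2)"

definition adj_rel :: "'a ugraph \<Rightarrow> 'a rel" where
  "adj_rel G = {(u, v). {u, v} \<in> edges G}"

text \<open>The graph without vertices is not connected; it never occurs as \<open>G - T\<close> below,
  since there \<open>T\<close> always has fewer elements than \<open>V(G)\<close>.\<close>

definition connected_graph :: "'a ugraph \<Rightarrow> bool" where
  "connected_graph G \<longleftrightarrow>
     verts G \<noteq> {} \<and> (\<forall>u\<in>verts G. \<forall>v\<in>verts G. (u, v) \<in> (adj_rel G)\<^sup>*)"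

definition component_verts :: "'a ugraph \<Rightarrow> 'a set set" where
  "component_verts G = {{v \<in> verts G. (u, v) \<in> (adj_rel G)\<^sup>*} | u. u \<in> verts G}"

definition del_verts :: "'a ugraph \<Rightarrow> 'a set \<Rightarrow> 'a ugraph" where
  "del_verts G T = \<lparr>verts = verts G - T, edges = {e \<in> edges G. e \<inter> T = {}}\<rparr>"

definition is_cycle :: "'a ugraph \<Rightarrow> 'a list \<Rightarrow> bool" where
  "is_cycle G vs \<longleftrightarrow> 3 \<le> length vs \<and> distinct vs \<and>
     (\<forall>i<length vs. {vs ! i, vs ! (Suc i mod length vs)} \<in> edges G)"

definition is_tree :: "'a ugraph \<Rightarrow> bool" where
  "is_tree Q \<longleftrightarrow> simple_graph Q \<and> connected_graph Q \<and> (\<nexists>vs. is_cycle Q vs)"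

definition spanning_tree :: "'a ugraph \<Rightarrow> 'a ugraph \<Rightarrow> bool" where
  "spanning_tree Q G \<longleftrightarrow> is_tree Q \<and> verts Q = verts G \<and> edges Q \<subseteq> edges G"

text \<open>The vertices of \<open>G/e\<close> are the blocks of the partition of \<open>V(G)\<close> that identifies the
  endvertices of \<open>e\<close>; images of edges that are not two-element sets (loops) are dropped,
  parallel edges coincide.\<close>

definition contract_map :: "'a set \<Rightarrow> 'a \<Rightarrow> 'a set" where
  "contract_map e v = (if v \<in> e then e else {v})"

definition contract :: "'a ugraph \<Rightarrow> 'a set \<Rightarrow> 'a set ugraph" where
  "contract G e = \<lparr>verts = contract_map e ` verts G,
     edges = {contract_map e ` f | f. f \<in> edges G \<and> card (contract_map e ` f) = 2}\<rparr>"

definition k_connected :: "nat \<Rightarrow> 'a ugraph \<Rightarrow> bool" where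
  "k_connected k G \<longleftrightarrow> card (verts G) > k \<and>
     (\<forall>T\<subseteq>verts G. card T < k \<longrightarrow> connected_graph (del_verts G T))"

definition connectivity :: "'a ugraph \<Rightarrow> nat" where
  "connectivity G = (GREATEST k. k_connected k G)"

definition k_contractible :: "nat \<Rightarrow> 'a ugraph \<Rightarrow> 'a set \<Rightarrow> bool" where
  "k_contractible k G e \<longleftrightarrow> e \<in> edges G \<and> k_connected k (contract G e)"

definition smallest_separating_sets :: "'a ugraph \<Rightarrow> 'a set set" where
  "smallest_separating_sets G =
     {T. T \<subseteq> verts G \<and> card T = connectivity G \<and> \<not> connected_graph (del_verts G T)}"

definition fragment :: "'a ugraph \<Rightarrow> 'a set \<Rightarrow> 'a set \<Rightarrow> bool" where
  "fragment G T F \<longleftrightarrow> T \<in> smallest_separating_sets G \<and>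
     (\<exists>\<C>. \<C> \<noteq> {} \<and> \<C> \<subset> component_verts (del_verts G T) \<and> F = \<Union>\<C>)"

definition T_S_fragment :: "'a ugraph \<Rightarrow> 'a set set \<Rightarrow> 'a set \<Rightarrow> 'a set \<Rightarrow> bool" where
  "T_S_fragment G \<SS> T F \<longleftrightarrow> fragment G T F \<and> (\<exists>S\<in>\<SS>. S \<subseteq> T)"

definition S_fragment :: "'a ugraph \<Rightarrow> 'a set set \<Rightarrow> 'a set \<Rightarrow> bool" where
  "S_fragment G \<SS> F \<longleftrightarrow> (\<exists>T\<in>smallest_separating_sets G. T_S_fragment G \<SS> T F)"

definition S_end :: "'a ugraph \<Rightarrow> 'a set set \<Rightarrow> 'a set \<Rightarrow> bool" where
  "S_end G \<SS> B \<longleftrightarrow> S_fragment G \<SS> B \<and> (\<nexists>F. S_fragment G \<SS> F \<and> F \<subset> B)"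

lemma k_connected_connectivity:
  assumes "verts G \<noteq> {}" "finite (verts G)"
  shows "k_connected (connectivity G) G"
  unfolding connectivity_def
proof (rule GreatestI_nat[where k = 0 and b = "card (verts G)"])
  show "k_connected 0 G"
    using assms by (auto simp: k_connected_def card_gt_0_iff)
qed (auto simp: k_connected_def)

lemma k_connected_le_connectivity:
  assumes "k_connected k G"
  shows "k \<le> connectivity G"
  unfolding connectivity_def using assms
  by (rule Greatest_le_nat[where b = "card (verts G)"]) (auto simp: k_connected_def)

lemma simple_graph_contract:
  assumes "simple_graph G"
  shows "simple_graph (contract G e)"
  using assms by (auto simp: simple_graph_def contract_def)

end

theory Submission
  imports Defs
begin

text \<open>Suppose that an edge \<open>e\<close> of \<open>Q\<close> with exactly one endvertex in the \<open>T\<close>-fragment \<open>B\<close> is not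
  contractible. Then \<open>e\<close> lies in a smallest separating set \<open>T'\<close>; let \<open>F\<close>, \<open>H\<close> be two complementary
  \<open>T'\<close>-fragments, and \<open>C\<close> the complementary \<open>T\<close>-fragment of \<open>B\<close>. If \<open>B \<inter> F\<close> is nonempty, its
  boundary \<open>(B \<inter> T') \<union> (T \<inter> T') \<union> (T \<inter> F)\<close> contains \<open>e\<close>, so it has more than \<open>k\<close> vertices because
  \<open>B\<close> is an end; similarly for \<open>B \<inter> H\<close>. The boundaries of nonempty \<open>C \<inter> F\<close> and \<open>C \<inter> H\<close> have at
  least \<open>k\<close> vertices. As \<open>B\<close>, \<open>C\<close>, \<open>F\<close>, \<open>H\<close> are all \<open>\<SS>\<close>-fragments, the lower bound on their
  cardinalities makes the resulting linear inequalities contradictory unless \<open>2 |B| = k - 1\<close>.\<close>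

section \<open>Separations and disconnected vertex deletions\<close>

text \<open>Neither side has to be connected and \<open>T\<close> may have any size. The notion thus
  covers a fragment with its complementary fragment as well as the boundaries of corners, and it is
  symmetric in the two sides.\<close>

definition separation :: "'a ugraph \<Rightarrow> 'a set \<Rightarrow> 'a set \<Rightarrow> 'a set \<Rightarrow> bool" where
  "separation G F T H \<longleftrightarrow> F \<union> T \<union> H = verts G \<and> F \<inter> T = {} \<and> F \<inter> H = {} \<and> T \<inter> H = {} \<and>
     F \<noteq> {} \<and> H \<noteq> {} \<and> (\<forall>u\<in>F. \<forall>v\<in>H. {u, v} \<notin> edges G)"

lemma separation_sym: "separation G F T H \<Longrightarrow> separation G H T F"
  unfolding separation_def by (simp add: Un_ac Int_commute) (metis insert_commute)

lemma finite_separation: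
  assumes "finite (verts G)" "separation G F T H"
  shows "finite F" "finite T" "finite H"
  using assms unfolding separation_def by (metis finite_Un)+

lemma sym_adj_rel: "sym (adj_rel G)"
  by (auto simp: adj_rel_def sym_def insert_commute)

lemma adj_rel_del_verts: "(u, v) \<in> adj_rel (del_verts G T) \<longleftrightarrow> {u, v} \<in> edges G \<and> u \<notin> T \<and> v \<notin> T"
  by (auto simp: adj_rel_def del_verts_def)

lemma verts_del_verts [simp]: "verts (del_verts G T) = verts G - T"
  by (simp add: del_verts_def)

lemma separation_closed:
  assumes "simple_graph G" "separation G F T H" "u \<in> F" "(u, v) \<in> (adj_rel (del_verts G T))\<^sup>*"
  shows "v \<in> F"
  using assms(4,3)
proof (induction rule: rtrancl_induct)
  case (step y z)
  then have "{y, z} \<in> edges G" "z \<notin> T" "y \<in> F"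
    by (auto simp: adj_rel_del_verts)
  moreover from this have "z \<in> verts G"
    using assms(1) by (auto simp: simple_graph_def)
  ultimately show ?case
    using assms(2) by (auto simp: separation_def)
qed

lemma separation_not_connected:
  assumes "simple_graph G" "separation G F T H"
  shows "\<not> connected_graph (del_verts G T)"
proof
  assume conn: "connected_graph (del_verts G T)"
  obtain u v where "u \<in> F" "v \<in> H"
    using assms(2) by (auto simp: separation_def)
  moreover from this have "u \<in> verts G - T" "v \<in> verts G - T" "v \<notin> F"
    using assms(2) by (auto simp: separation_def)
  ultimately show False
    using conn separation_closed[OF assms] by (auto simp: connected_graph_def)
qed

text \<open>One side is the component of a vertex \<open>u\<close> that does not reach
  \<open>v\<close>. Properness of \<open>T\<close> excludes the empty remainder, which counts as
  disconnected but has no two sides.\<close>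

lemma not_connected_separation:
  assumes "T \<subset> verts G" "\<not> connected_graph (del_verts G T)"
  shows "\<exists>F H. separation G F T H"
proof -
  let ?R = "(adj_rel (del_verts G T))\<^sup>*"
  obtain u v where uv: "u \<in> verts G - T" "v \<in> verts G - T" "(u, v) \<notin> ?R"
    using assms by (auto simp: connected_graph_def)
  define F where "F = {x \<in> verts G - T. (u, x) \<in> ?R}"
  have "{x, y} \<notin> edges G" if "x \<in> F" "y \<in> verts G - T - F" for x y
  proof
    assume "{x, y} \<in> edges G"
    then have "(x, y) \<in> adj_rel (del_verts G T)"
      using that by (auto simp: F_def adj_rel_del_verts)
    then have "(u, y) \<in> ?R"
      using that(1) by (auto simp: F_def intro: rtrancl_into_rtrancl)
    then show False
      using that(2) by (auto simp: F_def)
  qed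
  moreover have "u \<in> F" "v \<in> verts G - T - F" "F \<subseteq> verts G - T"
    using uv by (auto simp: F_def)
  ultimately have "separation G F T (verts G - T - F)"
    using assms(1) by (auto simp: separation_def)
  then show ?thesis by blast
qed

lemma k_connected_separation:
  assumes "simple_graph G" "k_connected k G" "separation G F T H"
  shows "k \<le> card T"
proof (rule ccontr)
  assume "\<not> k \<le> card T"
  moreover have "T \<subseteq> verts G"
    using assms(3) by (auto simp: separation_def)
  ultimately show False
    using assms(2) separation_not_connected[OF assms(1,3)] by (auto simp: k_connected_def)
qed

section \<open>Fragments as sides of separations\<close>

text \<open>A union of components of \<open>G - T\<close> sends no edge to the other components.
  Conversely, a side of a separation contains the component of each of its vertices.\<close>

lemma fragment_iff_separation:
  assumes "simple_graph G"
  shows "fragment G T F \<longleftrightarrow> card T = connectivity G \<and> separation G F T (verts G - T - F)"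
proof
  let ?D = "del_verts G T"
  assume "fragment G T F"
  then obtain \<C> where T: "T \<subseteq> verts G" "card T = connectivity G"
    and C: "\<C> \<noteq> {}" "\<C> \<subset> component_verts ?D" and F: "F = \<Union>\<C>"
    by (auto simp: fragment_def smallest_separating_sets_def)
  \<comment> \<open>Components that share a vertex coincide. Hence a component left out of the
    family supplies a vertex outside \<open>F\<close>.\<close>
  have disj: "X = Y" if X: "X \<in> component_verts ?D" and Y: "Y \<in> component_verts ?D"
    and "w \<in> X" "w \<in> Y" for X Y w
  proof -
    obtain x y where X: "X = {v \<in> verts ?D. (x, v) \<in> (adj_rel ?D)\<^sup>*}"
      and Y: "Y = {v \<in> verts ?D. (y, v) \<in> (adj_rel ?D)\<^sup>*}"
      using X Y by (auto simp: component_verts_def)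
    have "(w, x) \<in> (adj_rel ?D)\<^sup>*" "(w, y) \<in> (adj_rel ?D)\<^sup>*"
      using that X Y sym_rtrancl[OF sym_adj_rel, of ?D] by (auto dest: symD)
    moreover have "(x, w) \<in> (adj_rel ?D)\<^sup>*" "(y, w) \<in> (adj_rel ?D)\<^sup>*"
      using that X Y by auto
    ultimately show ?thesis
      unfolding X Y by (auto intro: rtrancl_trans)
  qed
  have inhabited: "\<exists>x\<in>verts G - T. x \<in> X" if "X \<in> component_verts ?D" for X
    using that by (auto simp: component_verts_def)
  have sub: "F \<subseteq> verts G - T"
    using C F by (auto simp: component_verts_def)
  have "F \<noteq> {}"
    using C F inhabited by blast
  moreover have "verts G - T - F \<noteq> {}"
  proof -
    obtain Y where Y: "Y \<in> component_verts ?D" "Y \<notin> \<C>"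
      using C by blast
    then obtain y where "y \<in> verts G - T" "y \<in> Y"
      using inhabited by blast
    moreover have "y \<notin> F"
      using C F Y disj \<open>y \<in> Y\<close> by blast
    ultimately show ?thesis by blast
  qed
  moreover have "{u, v} \<notin> edges G" if "u \<in> F" "v \<in> verts G - T - F" for u v
  proof
    assume "{u, v} \<in> edges G"
    then have uv: "(u, v) \<in> adj_rel ?D"
      using that sub by (auto simp: adj_rel_del_verts)
    from \<open>u \<in> F\<close> obtain X where X: "X \<in> \<C>" "u \<in> X"
      unfolding F by blast
    then obtain x where "X = {v \<in> verts ?D. (x, v) \<in> (adj_rel ?D)\<^sup>*}"
      using C by (auto simp: component_verts_def)
    then have "v \<in> X"
      using X uv that by (auto intro: rtrancl_into_rtrancl)
    then show False
      using X F that by blast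
  qed
  ultimately show "card T = connectivity G \<and> separation G F T (verts G - T - F)"
    using T sub by (auto simp: separation_def)
next
  let ?D = "del_verts G T"
  assume asm: "card T = connectivity G \<and> separation G F T (verts G - T - F)"
  then have sep: "separation G F T (verts G - T - F)" by simp
  define comp where "comp u = {v \<in> verts ?D. (u, v) \<in> (adj_rel ?D)\<^sup>*}" for u
  have sub: "F \<subseteq> verts G - T" "T \<subseteq> verts G"
    using sep by (auto simp: separation_def)
  have "comp u \<subseteq> F" if "u \<in> F" for u
    using separation_closed[OF assms sep that] by (auto simp: comp_def)
  moreover have refl: "u \<in> comp u" if "u \<in> verts G - T" for u
    using that by (auto simp: comp_def)
  ultimately have F: "F = \<Union>(comp ` F)"
    using sub by blast
  obtain w where w: "w \<in> verts G - T - F"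
    using sep by (auto simp: separation_def)
  have all: "component_verts ?D = comp ` (verts G - T)"
    by (auto simp: component_verts_def comp_def)
  have "comp w \<notin> comp ` F"
    using w refl[of w] F by blast
  then have "comp ` F \<subset> component_verts ?D"
    using w sub unfolding all by blast
  moreover have "comp ` F \<noteq> {}"
    using sep by (auto simp: separation_def)
  moreover have "T \<in> smallest_separating_sets G"
    using asm sub separation_not_connected[OF assms sep]
    by (auto simp: smallest_separating_sets_def)
  ultimately show "fragment G T F"
    using F unfolding fragment_def by (intro conjI exI[of _ "comp ` F"])
qed

lemma fragmentI_separation:
  assumes "simple_graph G" "separation G F T H" "card T = connectivity G"
  shows "fragment G T F"
proof -
  have "verts G - T - F = H"
    using assms(2) by (auto simp: separation_def)
  then show ?thesis
    using assms by (simp add: fragment_iff_separation)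
qed

lemma S_fragment_iff: "S_fragment G \<SS> F \<longleftrightarrow> (\<exists>T. fragment G T F \<and> (\<exists>S\<in>\<SS>. S \<subseteq> T))"
  unfolding S_fragment_def T_S_fragment_def fragment_def by blast

section \<open>Corners of two crossing separations\<close>

text \<open>A neighbour of a vertex in \<open>B \<inter> F\<close> lies neither in \<open>C\<close>
  nor in \<open>H\<close>, so the boundary consists of what remains of \<open>B \<union> T\<close>
  and \<open>F \<union> T'\<close> outside the corner. The other three corners arise by swapping
  sides.\<close>

lemma separation_corner:
  assumes "separation G B T C" "separation G F T' H" "B \<inter> F \<noteq> {}"
  shows "separation G (B \<inter> F) (B \<inter> T' \<union> T \<inter> T' \<union> T \<inter> F) (C \<union> H)"
proof -
  have V: "verts G = B \<union> T \<union> C" "verts G = F \<union> T' \<union> H"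
    and disj: "B \<inter> T = {}" "B \<inter> C = {}" "T \<inter> C = {}" "F \<inter> T' = {}" "F \<inter> H = {}" "T' \<inter> H = {}"
    and "C \<noteq> {}"
    and no: "\<forall>u\<in>B. \<forall>v\<in>C. {u, v} \<notin> edges G" "\<forall>u\<in>F. \<forall>v\<in>H. {u, v} \<notin> edges G"
    using assms(1,2) unfolding separation_def by simp_all
  have "(B \<union> T \<union> C) \<inter> (F \<union> T' \<union> H) \<subseteq> B \<inter> F \<union> (B \<inter> T' \<union> T \<inter> T' \<union> T \<inter> F) \<union> (C \<union> H)"
    by blast
  moreover have "B \<subseteq> verts G" "T \<subseteq> verts G" "C \<subseteq> verts G" "H \<subseteq> verts G"
    using V by auto
  ultimately have "B \<inter> F \<union> (B \<inter> T' \<union> T \<inter> T' \<union> T \<inter> F) \<union> (C \<union> H) = verts G"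
    unfolding V[symmetric] by blast
  moreover have "B \<inter> F \<inter> (B \<inter> T' \<union> T \<inter> T' \<union> T \<inter> F) = {}" "B \<inter> F \<inter> (C \<union> H) = {}"
    "(B \<inter> T' \<union> T \<inter> T' \<union> T \<inter> F) \<inter> (C \<union> H) = {}"
    using disj by auto
  moreover have "\<forall>u\<in>B \<inter> F. \<forall>v\<in>C \<union> H. {u, v} \<notin> edges G"
    using no by auto
  ultimately show ?thesis
    using assms(3) \<open>C \<noteq> {}\<close> unfolding separation_def by simp
qed

lemma card_split3:
  assumes "finite X" "X \<subseteq> A \<union> B \<union> C" "A \<inter> B = {}" "A \<inter> C = {}" "B \<inter> C = {}"
  shows "card X = card (X \<inter> A) + card (X \<inter> B) + card (X \<inter> C)"
proof -
  have "X = (X \<inter> A \<union> X \<inter> B) \<union> X \<inter> C"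
    using assms(2) by blast
  then have "card X = card ((X \<inter> A \<union> X \<inter> B) \<union> X \<inter> C)" by simp
  also have "\<dots> = card (X \<inter> A \<union> X \<inter> B) + card (X \<inter> C)"
    using assms by (intro card_Un_disjoint) auto
  also have "card (X \<inter> A \<union> X \<inter> B) = card (X \<inter> A) + card (X \<inter> B)"
    using assms by (intro card_Un_disjoint) auto
  finally show ?thesis .
qed

lemma card_corner:
  assumes "simple_graph G" "k_connected k G" "separation G B T C" "separation G F T' H" "B \<inter> F \<noteq> {}"
  shows "k \<le> card (B \<inter> T') + card (T \<inter> T') + card (T \<inter> F)"
proof -
  have "k \<le> card (B \<inter> T' \<union> T \<inter> T' \<union> T \<inter> F)"
    using k_connected_separation[OF assms(1,2) separation_corner[OF assms(3-5)]] .
  also have "\<dots> \<le> card (B \<inter> T') + card (T \<inter> T') + card (T \<inter> F)"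
    by (meson add_le_mono1 card_Un_le le_trans)
  finally show ?thesis .
qed

lemma card_corner_S_end:
  assumes "simple_graph G" "verts G \<noteq> {}" "S_end G \<SS> B" "separation G B T C" "separation G F T' H"
    and "e \<in> \<SS>" "e \<subseteq> T'" "e \<subseteq> B \<union> T" "e \<inter> B \<noteq> {}" "B \<inter> F \<noteq> {}"
  shows "connectivity G < card (B \<inter> T') + card (T \<inter> T') + card (T \<inter> F)"
proof -
  let ?N = "B \<inter> T' \<union> T \<inter> T' \<union> T \<inter> F"
  have sep: "separation G (B \<inter> F) ?N (C \<union> H)"
    using separation_corner[OF assms(4,5,10)] .
  have "e \<subseteq> ?N"
    using assms(7,8) by blast
  then have "S_fragment G \<SS> (B \<inter> F)" if "card ?N = connectivity G"
    using fragmentI_separation[OF assms(1) sep that] assms(6) by (auto simp: S_fragment_iff)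
  \<comment> \<open>The endvertex of \<open>e\<close> in \<open>B\<close> lies in \<open>T'\<close>
    and hence outside \<open>F\<close>.\<close>
  moreover have "B \<inter> F \<subset> B"
    using assms(5,7,9) by (auto simp: separation_def)
  ultimately have "card ?N \<noteq> connectivity G"
    using assms(3) by (auto simp: S_end_def)
  moreover have "k_connected (connectivity G) G"
    using assms(1,2) by (intro k_connected_connectivity) (auto simp: simple_graph_def)
  then have "connectivity G \<le> card ?N"
    using assms(1) sep by (intro k_connected_separation)
  moreover have "card ?N \<le> card (B \<inter> T') + card (T \<inter> T') + card (T \<inter> F)"
    by (meson add_le_mono1 card_Un_le le_trans)
  ultimately show ?thesis by linarith
qed

section \<open>Contraction and its separating sets\<close>

lemma inj_on_contract_map:
  assumes "card e = 2" "t \<in> e"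
  shows "inj_on (contract_map e) (- {t})"
proof -
  obtain s where e: "e = {s, t}" "s \<noteq> t"
    using assms by (auto simp: card_2_iff)
  show ?thesis
    by (rule inj_onI) (use e in \<open>auto simp: contract_map_def split: if_splits\<close>)
qed

lemma card_verts_contract:
  assumes "simple_graph G" "e \<in> edges G"
  shows "card (verts (contract G e)) = card (verts G) - 1"
proof -
  have e: "card e = 2" "e \<subseteq> verts G"
    using assms by (auto simp: simple_graph_def)
  then obtain s t where st: "e = {s, t}" "s \<noteq> t"
    by (auto simp: card_2_iff)
  have "contract_map e t = contract_map e s"
    using st by (simp add: contract_map_def)
  then have "contract_map e ` verts G = contract_map e ` (verts G - {t})"
    using st e(2) by auto
  then have "card (verts (contract G e)) = card (verts G - {t})"
    using inj_on_contract_map[OF e(1), of t] st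
    by (simp add: contract_def card_image inj_on_subset)
  then show ?thesis
    using st e(2) by simp
qed

text \<open>An edge between the two preimages would have distinct end blocks, so it would survive as
  an edge of \<open>G/e\<close> between \<open>F\<close> and \<open>H\<close>.\<close>

lemma separation_contract_vimage:
  assumes "separation (contract G e) F S H"
  shows "separation G (verts G \<inter> contract_map e -` F) (verts G \<inter> contract_map e -` S)
    (verts G \<inter> contract_map e -` H)"
proof -
  let ?p = "contract_map e"
  have un: "F \<union> S \<union> H = ?p ` verts G" and disj: "F \<inter> S = {}" "F \<inter> H = {}" "S \<inter> H = {}"
    and ne: "F \<noteq> {}" "H \<noteq> {}" and no: "\<forall>u\<in>F. \<forall>v\<in>H. {u, v} \<notin> edges (contract G e)"
    using assms by (auto simp: separation_def contract_def)
  have "{u, v} \<notin> edges G" if "?p u \<in> F" "?p v \<in> H" for u v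
  proof
    assume uv: "{u, v} \<in> edges G"
    have "?p u \<noteq> ?p v"
      using that disj by auto
    then have "card (?p ` {u, v}) = 2" by simp
    then have "?p ` {u, v} \<in> edges (contract G e)"
      using uv unfolding contract_def ugraph.select_convs by blast
    then show False
      using no that by auto
  qed
  moreover have "verts G \<inter> ?p -` F \<noteq> {}" "verts G \<inter> ?p -` H \<noteq> {}"
    using equalityD1[OF un] ne by blast+
  moreover have "verts G \<subseteq> ?p -` F \<union> ?p -` S \<union> ?p -` H"
    using equalityD2[OF un] by blast
  moreover have "?p -` F \<inter> ?p -` S = {}" "?p -` F \<inter> ?p -` H = {}" "?p -` S \<inter> ?p -` H = {}"
    using disj by auto
  ultimately show ?thesis
    unfolding separation_def by (intro conjI) (auto simp: set_eq_iff)
qed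

text \<open>Some \<open>S\<close> with fewer than \<open>k\<close> blocks separates
  \<open>G/e\<close>. Its preimage separates \<open>G\<close>, so it has at least \<open>k\<close>
  vertices, yet it exceeds \<open>S\<close> by at most one vertex. This forces \<open>e\<close> to
  be a block in \<open>S\<close> and the preimage to have exactly \<open>k\<close> vertices.\<close>

lemma not_contractible_separation:
  assumes G: "simple_graph G" "e \<in> edges G" "k_connected k G"
    and "k + 2 \<le> card (verts G)" "\<not> k_contractible k G e"
  obtains F T H where "separation G F T H" "card T = k" "e \<subseteq> T"
proof -
  let ?p = "contract_map e"
  have fin: "finite (verts G)" and e: "card e = 2" "e \<subseteq> verts G"
    using G by (auto simp: simple_graph_def)
  have card: "k < card (verts (contract G e))"
    using card_verts_contract[OF G(1,2)] assms(4) by simp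
  then obtain S where S: "S \<subseteq> verts (contract G e)" "card S < k"
    "\<not> connected_graph (del_verts (contract G e) S)"
    using assms(2,5) by (auto simp: k_contractible_def k_connected_def)
  moreover have "S \<noteq> verts (contract G e)"
    using S card by auto
  ultimately obtain F H where FH: "separation (contract G e) F S H"
    using not_connected_separation[of S "contract G e"] by auto
  let ?T = "verts G \<inter> ?p -` S"
  have sep: "separation G (verts G \<inter> ?p -` F) ?T (verts G \<inter> ?p -` H)"
    using separation_contract_vimage[OF FH] .
  have T: "k \<le> card ?T"
    using k_connected_separation[OF G(1,3) sep] .
  have finS: "finite S"
    using S(1) fin by (auto simp: contract_def intro: finite_subset)
  obtain t where t: "t \<in> e"
    using e by fastforce
  have le: "card (?T - {t}) \<le> card S"
    using inj_on_contract_map[OF e(1) t] finS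
    by (intro card_inj_on_le[of ?p]) (auto intro: inj_on_subset)
  \<comment> \<open>Otherwise the whole preimage would inject into \<open>S\<close>, which has fewer
    than \<open>k\<close> elements.\<close>
  have "t \<in> ?T"
    using T le S(2) by (cases "t \<in> ?T") auto
  then have "e \<in> S"
    using t by (simp add: contract_map_def)
  then have "e \<subseteq> ?T"
    using e(2) by (auto simp: contract_map_def)
  moreover have "card ?T = k"
    using T le S(2) \<open>t \<in> ?T\<close> fin by simp
  ultimately show ?thesis
    using that sep by blast
qed

text \<open>Here \<open>bf\<close> stands for \<open>|B \<inter> F|\<close>, \<open>bt\<close> for \<open>|B \<inter> T'|\<close>, \<open>tf\<close> for \<open>|T \<inter> F|\<close>, and so on.\<close>

lemma crossing_counts_contradiction:
  fixes k bf bt bh tf tt th cf ct ch :: nat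
  assumes "bf = 0 \<or> k < bt + tt + tf" "bh = 0 \<or> k < bt + tt + th"
    and "cf = 0 \<or> k \<le> ct + tt + tf" "ch = 0 \<or> k \<le> ct + tt + th"
    and "tf + tt + th = k" "bt + tt + ct = k" "0 < tt"
    and "k \<le> 2 * bf + 2 * bt + 2 * bh" "k \<le> 2 * cf + 2 * ct + 2 * ch + 1"
    and "k \<le> 2 * bf + 2 * tf + 2 * cf + 1" "k \<le> 2 * bh + 2 * th + 2 * ch + 1"
  shows False
  \<comment> \<open>Each case contradicts \<open>bt + ct = k - tt\<close> with
    \<open>0 < tt\<close>. If \<open>bf\<close> and \<open>bh\<close> are positive, then
    \<open>cf = ch = 0\<close>, so \<open>2 * ct \<ge> k - 1\<close> and
    \<open>2 * bt \<ge> k + 2 - tt\<close>. If only \<open>bf\<close> is, then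
    \<open>ch = 0\<close>, so \<open>2 * th \<ge> k - 1\<close>, \<open>bt > th\<close> and again
    \<open>2 * ct \<ge> k - 1\<close>; likewise for \<open>bh\<close>. If neither is, then
    \<open>2 * bt \<ge> k\<close>, and \<open>2 * ct\<close> is at least \<open>k - 1\<close> or,
    when \<open>cf\<close> and \<open>ch\<close> are both positive, \<open>k - tt\<close>.\<close>
  using assms by linarith

section \<open>Counting around an end and a non-contractible edge\<close>

theorem theorem7:
  fixes G Q :: "'a ugraph" and k :: nat and B :: "'a set"
  assumes "simple_graph G"
    and "connectivity G = k"
    and "spanning_tree Q G"
    and "\<And>F. S_fragment G (edges Q) F \<Longrightarrow> real (card F) \<ge> (real k - 1) / 2"
    and "S_end G (edges Q) B"
  shows "(real (card B) = (real k - 1) / 2 \<and> odd k) \<or>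
         (\<forall>e\<in>edges Q. card (e \<inter> B) = 1 \<longrightarrow> k_contractible k G e)"
proof (rule ccontr)
  assume neg: "\<not> ?thesis"
  \<comment> \<open>Clearing the denominator gives a bound over the naturals without truncated
    subtraction.\<close>
  have bound: "k \<le> 2 * card F + 1" if "S_fragment G (edges Q) F" for F
  proof -
    have "real k \<le> real (2 * card F + 1)"
      using assms(4)[OF that] by simp
    then show ?thesis
      by (simp only: of_nat_le_iff)
  qed
  have fragS: "S_fragment G (edges Q) X"
    if "separation G X Y Z" "card Y = k" "S \<in> edges Q" "S \<subseteq> Y" for X Y Z S
  proof -
    have "fragment G Y X"
      using fragmentI_separation[OF assms(1) that(1)] that(2) assms(2) by simp
    then show ?thesis
      using that(3,4) unfolding S_fragment_iff by blast
  qed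
  obtain e where e: "e \<in> edges Q" "card (e \<inter> B) = 1" "\<not> k_contractible k G e"
    using neg by blast
  then have eG: "e \<in> edges G" "card e = 2" "e \<subseteq> verts G"
    using assms(1,3) by (auto simp: spanning_tree_def simple_graph_def)
  have "S_fragment G (edges Q) B"
    using assms(5) by (simp add: S_end_def)
  then obtain T S where frag: "fragment G T B" and S: "S \<in> edges Q" "S \<subseteq> T"
    by (auto simp: S_fragment_iff)
  define C where "C = verts G - T - B"
  have BTC: "separation G B T C" and T: "card T = k"
    using frag fragment_iff_separation[OF assms(1)] assms(2) by (auto simp: C_def)
  have fin: "finite (verts G)"
    using assms(1) by (simp add: simple_graph_def)
  note finBTC = finite_separation[OF fin BTC]
  have ne: "verts G \<noteq> {}"
    using BTC by (auto simp: separation_def)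
  have conn: "k_connected k G"
    using k_connected_connectivity[OF ne fin] assms(2) by simp
  have "verts G \<inter> B = B" "verts G \<inter> T = T" "verts G \<inter> C = C"
    using BTC by (auto simp: separation_def)
  then have "card (verts G) = card B + card T + card C"
    using card_split3[of "verts G" B T C] BTC fin by (simp add: separation_def)
  moreover have "card B > 0" "card C > 0"
    using BTC finBTC by (auto simp: separation_def card_gt_0_iff)
  \<comment> \<open>With this many vertices \<open>G/e\<close> still has more than \<open>k\<close>,
    so its failure to be \<open>k\<close>-connected comes from a small separating set.\<close>
  ultimately have "k + 2 \<le> card (verts G)"
    using T by simp
  then obtain F T' H where FTH: "separation G F T' H" "card T' = k" "e \<subseteq> T'"
    using not_contractible_separation[OF assms(1) eG(1) conn _ e(3)] by blast
  note finFTH = finite_separation[OF fin FTH(1)]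

  obtain b t where bt: "e = {b, t}" "b \<in> B" "t \<notin> B"
  proof -
    obtain x y where "e = {x, y}" "x \<noteq> y"
      using eG(2) by (auto simp: card_2_iff)
    then show ?thesis
      using e(2) that[of x y] that[of y x] by (cases "x \<in> B"; cases "y \<in> B") auto
  qed
  \<comment> \<open>No edge joins \<open>B\<close> to \<open>C\<close>, so the endvertex of
    \<open>e\<close> outside \<open>B\<close> must be in \<open>T\<close>.\<close>
  then have tT: "t \<in> T"
    using eG BTC by (auto simp: separation_def)
  have eBT: "e \<subseteq> B \<union> T" "e \<inter> B \<noteq> {}"
    using bt tT by auto

  note HTF = separation_sym[OF FTH(1)] and CTB = separation_sym[OF BTC]
  have corners:
    "card (B \<inter> F) = 0 \<or> k < card (B \<inter> T') + card (T \<inter> T') + card (T \<inter> F)"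
    "card (B \<inter> H) = 0 \<or> k < card (B \<inter> T') + card (T \<inter> T') + card (T \<inter> H)"
    "card (C \<inter> F) = 0 \<or> k \<le> card (C \<inter> T') + card (T \<inter> T') + card (T \<inter> F)"
    "card (C \<inter> H) = 0 \<or> k \<le> card (C \<inter> T') + card (T \<inter> T') + card (T \<inter> H)"
    using card_corner_S_end[OF assms(1) ne assms(5) BTC FTH(1) e(1) FTH(3) eBT] assms(2)
      card_corner_S_end[OF assms(1) ne assms(5) BTC HTF e(1) FTH(3) eBT]
      card_corner[OF assms(1) conn CTB FTH(1)] card_corner[OF assms(1) conn CTB HTF]
    by fastforce+
  have rows:
    "card B = card (B \<inter> F) + card (B \<inter> T') + card (B \<inter> H)"
    "card T = card (T \<inter> F) + card (T \<inter> T') + card (T \<inter> H)"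
    "card C = card (C \<inter> F) + card (C \<inter> T') + card (C \<inter> H)"
    using BTC FTH(1) finBTC by (auto intro!: card_split3 simp: separation_def)
  have columns:
    "card F = card (B \<inter> F) + card (T \<inter> F) + card (C \<inter> F)"
    "card T' = card (B \<inter> T') + card (T \<inter> T') + card (C \<inter> T')"
    "card H = card (B \<inter> H) + card (T \<inter> H) + card (C \<inter> H)"
    using BTC FTH(1) finFTH card_split3[of F B T C] card_split3[of T' B T C] card_split3[of H B T C]
    by (auto simp: separation_def Int_commute)
  \<comment> \<open>The edge \<open>S\<close> inside \<open>T\<close> makes \<open>B\<close> and
    \<open>C\<close> fragments of the family; the edge \<open>e\<close> inside \<open>T'\<close>
    does so for \<open>F\<close> and \<open>H\<close>.\<close>
  have "k \<le> 2 * card C + 1" "k \<le> 2 * card F + 1" "k \<le> 2 * card H + 1" "k \<le> 2 * card B + 1"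
    using bound[OF fragS[OF CTB T S]] bound[OF fragS[OF FTH(1,2) e(1) FTH(3)]]
      bound[OF fragS[OF HTF FTH(2) e(1) FTH(3)]] bound[OF fragS[OF BTC T S]] by simp_all
  \<comment> \<open>Equality would give the first alternative, including that \<open>k\<close> is
    odd. The bound for \<open>B\<close> thereby sharpens to
    \<open>k \<le> 2 * card B\<close>.\<close>
  moreover have "k \<noteq> 2 * card B + 1"
    using neg by auto
  moreover have "card (T \<inter> T') > 0"
    using tT bt FTH(3) finBTC by (auto simp: card_gt_0_iff)
  ultimately show False
    using crossing_counts_contradiction[OF corners] rows columns T FTH(2) by simp
qed

end
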